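(* In the setting below, the function $f_{\rm plt}\colon 2^R\to\mathbb{R}_+$ defined by \[ f_{\rm plt}(X)=\bigl|(V\setminus {\rm supp}(\phi))\cap N[X]\bigr| + \sum_{v \in (V\setminus {\rm supp}(\phi)) \setminus N[X]}\Bigl(1- \sum_{\psi \in \Psi_{X \cap H}:\, v \sim_{\psi} r}p(\psi)\Bigr) \] for $X\subseteq R$ is monotone (i.e., $f_{\rm plt}(X)\le f_{\rm plt}(Y)$ whenever $X\subseteq Y\subseteq R$) and submodular.
   Context: Let $G=(V,E)$ be an undirected graph with a root node $r\in V$. For $v\in V$, $N[v]$ denotes $v$ together with its neighbors, and for $X\subseteq V$, $N[X]=\bigcup_{v\in X}N[v]$; $G[X]$ is the subgraph induced by $X$. A full realization is a vector $\psi\in\{0,1\}^V$ with $\psi(r)=1$ ($\psi(v)=1$ means $v$ is active); $\Psi$ is the set of full realizations, and $p$ is a probability distribution on $\Psi$. Let $A_\psi=\{v:\psi(v)=1\}$. For $\psi\in\Psi$ and $u,v\in V$, write $u\sim_\psi v$ if $u,v$ are both active and lie in the same connected component of $G[A_\psi]$. A realization is a vector $\phi\in\{0,1,*\}^V$, with ${\rm supp}(\phi)=\{v:\phi(v)\ne *\}$; a vector $\psi$ extends $\phi$, written $\psi\succeq\phi$, if $\psi(v)=\phi(v)$ for all $v\in{\rm supp}(\phi)$. For $\psi\succeq\phi$, $p(\psi\mid\phi)=p(\psi)/\sum_{\psi'\in\Psi:\psi'\succeq\phi}p(\psi')$. Fix a realization $\phi$ with $\phi(r)=1$ and $\sum_{\psi\succeq\phi}p(\psi)>0$,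 and a set $U\subseteq{\rm supp}(\phi)$ with $r\in U$. Let $\Psi_\phi=\{\psi\in\Psi:\psi\succeq\phi,\ p(\psi)>0\}$, let $H=\{v\in V\setminus U:\sum_{\psi\in\Psi_\phi:\,v\in A_\psi}p(\psi\mid\phi)>1/2\}$, and let $R$ be the node set of the connected component of $G[U\cup H]$ containing $r$. For $v\in R\cap H$ define $\xi_v\in\{0,1,*\}^V$ by $\xi_v(u)=*$ for $u\notin N[v]$, $\xi_v(u)=1$ for $u\in H\cap N[v]$, and $\xi_v(u)=0$ for $u\in N[v]\setminus H$. For $H'\subseteq R\cap H$, let $\Psi_{H'}=\{\psi\in\Psi_\phi:\psi\succeq\xi_v \text{ for all } v\in H'\}$. *)

theory Defs
  imports "Graph_Theory.Digraph_Component" "HOL-Probability.Probability_Mass_Function"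
begin

text \<open>
  An undirected graph is a finite symmetric digraph (locale \<^locale>\<open>pseudo_graph\<close>); its connected
  components are therefore its strongly connected components.
\<close>

definition closed_nbhd :: "('a, 'b) pre_digraph \<Rightarrow> 'a \<Rightarrow> 'a set" where
  "closed_nbhd G v = insert v {u. v \<rightarrow>\<^bsub>G\<^esub> u}"

definition closed_nbhd_set :: "('a, 'b) pre_digraph \<Rightarrow> 'a set \<Rightarrow> 'a set" where
  "closed_nbhd_set G X = (\<Union>v\<in>X. closed_nbhd G v)"

text \<open>
  A vector in \<open>{0,1,*}\<^sup>V\<close> is a partial map with domain contained in \<open>V\<close>: \<open>Some True\<close> stands for 1,
  \<open>Some False\<close> for 0 and \<open>None\<close> for \<open>*\<close>. So the support is \<^const>\<open>dom\<close>, and \<open>\<psi>\<close> extends \<open>\<phi>\<close>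
  iff \<open>\<phi> \<subseteq>\<^sub>m \<psi>\<close>.
\<close>

definition full_realizations :: "('a, 'b) pre_digraph \<Rightarrow> 'a \<Rightarrow> ('a \<rightharpoonup> bool) set" where
  "full_realizations G r = {\<psi>. dom \<psi> = verts G \<and> \<psi> r = Some True}"

definition active :: "('a \<rightharpoonup> bool) \<Rightarrow> 'a set" where
  "active \<psi> = {v. \<psi> v = Some True}"

definition same_component :: "('a, 'b) pre_digraph \<Rightarrow> ('a \<rightharpoonup> bool) \<Rightarrow> 'a \<Rightarrow> 'a \<Rightarrow> bool" where
  "same_component G \<psi> u v \<longleftrightarrow> u \<in> active \<psi> \<and> v \<in> active \<psi> \<and>
     (\<exists>C \<in> pre_digraph.sccs_verts (G \<restriction> active \<psi>). u \<in> C \<and> v \<in> C)"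

definition extension_mass ::
  "('a, 'b) pre_digraph \<Rightarrow> 'a \<Rightarrow> ('a \<rightharpoonup> bool) pmf \<Rightarrow> ('a \<rightharpoonup> bool) \<Rightarrow> real" where
  "extension_mass G r p \<phi> = (\<Sum>\<psi> | \<psi> \<in> full_realizations G r \<and> \<phi> \<subseteq>\<^sub>m \<psi>. pmf p \<psi>)"

definition posterior ::
  "('a, 'b) pre_digraph \<Rightarrow> 'a \<Rightarrow> ('a \<rightharpoonup> bool) pmf \<Rightarrow> ('a \<rightharpoonup> bool) \<Rightarrow> ('a \<rightharpoonup> bool) \<Rightarrow> real" where
  "posterior G r p \<phi> \<psi> = pmf p \<psi> / extension_mass G r p \<phi>"

definition consistent ::
  "('a, 'b) pre_digraph \<Rightarrow> 'a \<Rightarrow> ('a \<rightharpoonup> bool) pmf \<Rightarrow> ('a \<rightharpoonup> bool) \<Rightarrow> ('a \<rightharpoonup> bool) set" where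
  "consistent G r p \<phi> = {\<psi> \<in> full_realizations G r. \<phi> \<subseteq>\<^sub>m \<psi> \<and> pmf p \<psi> > 0}"

definition likely_active ::
  "('a, 'b) pre_digraph \<Rightarrow> 'a \<Rightarrow> ('a \<rightharpoonup> bool) pmf \<Rightarrow> ('a \<rightharpoonup> bool) \<Rightarrow> 'a set \<Rightarrow> 'a set" where
  "likely_active G r p \<phi> U =
     {v \<in> verts G - U.
        (\<Sum>\<psi> | \<psi> \<in> consistent G r p \<phi> \<and> v \<in> active \<psi>. posterior G r p \<phi> \<psi>) > 1 / 2}"

definition root_component ::
  "('a, 'b) pre_digraph \<Rightarrow> 'a \<Rightarrow> ('a \<rightharpoonup> bool) pmf \<Rightarrow> ('a \<rightharpoonup> bool) \<Rightarrow> 'a set \<Rightarrow> 'a set" where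
  "root_component G r p \<phi> U = pre_digraph.scc_of (G \<restriction> (U \<union> likely_active G r p \<phi> U)) r"

definition local_realization ::
  "('a, 'b) pre_digraph \<Rightarrow> 'a set \<Rightarrow> 'a \<Rightarrow> ('a \<rightharpoonup> bool)" where
  "local_realization G H v =
     (\<lambda>u. if u \<notin> closed_nbhd G v then None else if u \<in> H then Some True else Some False)"

definition consistent_local ::
  "('a, 'b) pre_digraph \<Rightarrow> 'a \<Rightarrow> ('a \<rightharpoonup> bool) pmf \<Rightarrow> ('a \<rightharpoonup> bool) \<Rightarrow> 'a set \<Rightarrow> 'a set
     \<Rightarrow> ('a \<rightharpoonup> bool) set" where
  "consistent_local G r p \<phi> U H' =
     {\<psi> \<in> consistent G r p \<phi>. \<forall>v\<in>H'. local_realization G (likely_active G r p \<phi> U) v \<subseteq>\<^sub>m \<psi>}"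

definition f_plt ::
  "('a, 'b) pre_digraph \<Rightarrow> 'a \<Rightarrow> ('a \<rightharpoonup> bool) pmf \<Rightarrow> ('a \<rightharpoonup> bool) \<Rightarrow> 'a set \<Rightarrow> 'a set \<Rightarrow> real" where
  "f_plt G r p \<phi> U X =
     real (card ((verts G - dom \<phi>) \<inter> closed_nbhd_set G X)) +
     (\<Sum>v \<in> (verts G - dom \<phi>) - closed_nbhd_set G X.
        1 - (\<Sum>\<psi> | \<psi> \<in> consistent_local G r p \<phi> U (X \<inter> likely_active G r p \<phi> U) \<and>
                     same_component G \<psi> v r. pmf p \<psi>))"

definition submodular_on :: "'a set \<Rightarrow> ('a set \<Rightarrow> real) \<Rightarrow> bool" where
  "submodular_on R f \<longleftrightarrow>
     (\<forall>X Y. X \<subseteq> R \<longrightarrow> Y \<subseteq> R \<longrightarrow> f (X \<union> Y) + f (X \<inter> Y) \<le> f X + f Y)"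

end

theory Submission
  imports Defs
begin

text \<open>
  A pair \<open>(v, \<psi>)\<close> contributes \<open>p(\<psi>)\<close> to the loss \<open>|V \ supp(\<phi>)| - f(X)\<close> iff every single
  \<open>u \<in> X\<close> is compatible with it: \<open>v \<notin> N[u]\<close>, and \<open>\<psi>\<close> extends \<open>\<xi>\<^sub>u\<close> in case \<open>u \<in> H\<close>. So the loss is
  a nonnegative combination of set functions of the form \<open>X \<mapsto> [X \<subseteq> S]\<close>, each of which is
  antitone and supermodular.
\<close>

text \<open>If both conditions on the left hold, so do both on the right; if only one holds, it
  still passes to \<open>X \<inter> Y\<close>.\<close>

lemma of_bool_Ball_supermodular:
  "of_bool (\<forall>u\<in>X. P u) + of_bool (\<forall>u\<in>Y. P u)
    \<le> of_bool (\<forall>u\<in>X \<union> Y. P u) + (of_bool (\<forall>u\<in>X \<inter> Y. P u) :: real)"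
  by (auto simp: of_bool_def)

lemma finite_full_realizations:
  assumes "finite (verts G)"
  shows "finite (full_realizations G r)"
proof (rule finite_subset)
  show "finite {\<psi>. dom \<psi> = verts G \<and> ran \<psi> \<subseteq> (UNIV :: bool set)}"
    by (rule finite_set_of_finite_maps) (use assms in simp_all)
qed (auto simp: full_realizations_def)

lemma finite_consistent:
  assumes "finite (verts G)"
  shows "finite (consistent G r p \<phi>)"
  by (rule finite_subset[OF _ finite_full_realizations[OF assms, of r]])
     (auto simp: consistent_def)

definition compatible ::
  "('a, 'b) pre_digraph \<Rightarrow> 'a set \<Rightarrow> 'a \<Rightarrow> ('a \<rightharpoonup> bool) \<Rightarrow> 'a \<Rightarrow> bool" where
  "compatible G H v \<psi> u \<longleftrightarrow>
     v \<notin> closed_nbhd G u \<and> (u \<in> H \<longrightarrow> local_realization G H u \<subseteq>\<^sub>m \<psi>)"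

text \<open>Neither range of summation depends on \<open>X\<close>: membership in
  \<open>N[X]\<close> and consistency with the \<open>\<xi>\<close> vectors are moved into the
  indicator, so losses of different sets can be compared term by term.\<close>

definition f_plt_loss ::
  "('a, 'b) pre_digraph \<Rightarrow> 'a \<Rightarrow> ('a \<rightharpoonup> bool) pmf \<Rightarrow> ('a \<rightharpoonup> bool) \<Rightarrow> 'a set \<Rightarrow> 'a set \<Rightarrow> real" where
  "f_plt_loss G r p \<phi> U X =
     (\<Sum>v \<in> verts G - dom \<phi>. \<Sum>\<psi> | \<psi> \<in> consistent G r p \<phi> \<and> same_component G \<psi> v r.
        pmf p \<psi> * of_bool (\<forall>u\<in>X. compatible G (likely_active G r p \<phi> U) v \<psi> u))"

lemma f_plt_eq_card_minus_loss:
  assumes fin: "finite (verts G)"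
  shows "f_plt G r p \<phi> U X = real (card (verts G - dom \<phi>)) - f_plt_loss G r p \<phi> U X"
proof -
  let ?W = "verts G - dom \<phi>" and ?N = "closed_nbhd_set G X"
  let ?H = "likely_active G r p \<phi> U"
  let ?C = "\<lambda>v. {\<psi>. \<psi> \<in> consistent G r p \<phi> \<and> same_component G \<psi> v r}"
  let ?D = "\<lambda>v. {\<psi>. \<psi> \<in> consistent_local G r p \<phi> U (X \<inter> ?H) \<and> same_component G \<psi> v r}"
  let ?q = "\<lambda>v. \<Sum>\<psi>\<in>?C v. pmf p \<psi> * of_bool (\<forall>u\<in>X. compatible G ?H v \<psi> u)"
  have finC: "finite (?C v)" for v
    using finite_consistent[OF fin, of r p \<phi>] by simp
  \<comment> \<open>Since \<open>v\<close> avoids every \<open>N[u]\<close>, only the extension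
    condition remains in \<open>compatible\<close>; the indicator is 1 on \<open>?D v\<close> and 0
    on the rest of \<open>?C v\<close>.\<close>
  have outside: "(\<Sum>\<psi>\<in>?D v. pmf p \<psi>) = ?q v" if "v \<notin> ?N" for v
    using that
    by (intro sum.mono_neutral_cong_left finC)
       (auto simp: consistent_local_def compatible_def closed_nbhd_set_def)
  \<comment> \<open>Some \<open>u\<close> in \<open>X\<close> has \<open>v\<close> in
    \<open>N[u]\<close>, and this \<open>u\<close> makes every indicator vanish.\<close>
  have inside: "?q v = 0" if "v \<in> ?N" for v
    using that by (intro sum.neutral) (auto simp: compatible_def closed_nbhd_set_def)
  have "(\<Sum>v\<in>?W - ?N. ?q v) = (\<Sum>v\<in>?W. ?q v)"
    using fin inside by (intro sum.mono_neutral_left) auto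
  moreover have "(\<Sum>v\<in>?W - ?N. 1 - (\<Sum>\<psi>\<in>?D v. pmf p \<psi>)) = real (card (?W - ?N)) - (\<Sum>v\<in>?W - ?N. ?q v)"
    using outside by (simp add: sum_subtractf)
  moreover have "card ?W = card (?W \<inter> ?N) + card (?W - ?N)"
    using fin by (simp add: card_Int_Diff)
  ultimately show ?thesis
    unfolding f_plt_def f_plt_loss_def by simp
qed

text \<open>Gives nonnegativity of \<open>f_plt\<close>: each node loses at most the probability of
  a set of realizations.\<close>

lemma f_plt_loss_le_card: "f_plt_loss G r p \<phi> U X \<le> real (card (verts G - dom \<phi>))"
proof -
  let ?H = "likely_active G r p \<phi> U"
  let ?C = "\<lambda>v. {\<psi>. \<psi> \<in> consistent G r p \<phi> \<and> same_component G \<psi> v r}"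
  have "(\<Sum>\<psi>\<in>?C v. pmf p \<psi> * of_bool (\<forall>u\<in>X. compatible G ?H v \<psi> u)) \<le> 1" for v
  proof -
    have "(\<Sum>\<psi>\<in>?C v. pmf p \<psi> * of_bool (\<forall>u\<in>X. compatible G ?H v \<psi> u)) \<le> (\<Sum>\<psi>\<in>?C v. pmf p \<psi>)"
      by (intro sum_mono) (simp add: mult_left_le)
    also have "\<dots> \<le> 1"
    proof (cases "finite (?C v)")
      case True
      then show ?thesis
        by (metis measure_measure_pmf_finite measure_pmf.prob_le_1)
    next
      \<comment> \<open>A sum over an infinite set is 0 by convention, so the bound
        persists.\<close>
      case False
      then show ?thesis
        by (metis sum.infinite zero_le_one)
    qed
    finally show ?thesis .
  qed
  then have "f_plt_loss G r p \<phi> U X \<le> (\<Sum>v\<in>verts G - dom \<phi>. 1)"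
    unfolding f_plt_loss_def by (intro sum_mono)
  then show ?thesis
    by simp
qed

lemma f_plt_loss_antimono:
  assumes "X \<subseteq> Y"
  shows "f_plt_loss G r p \<phi> U Y \<le> f_plt_loss G r p \<phi> U X"
  unfolding f_plt_loss_def
  using assms by (intro sum_mono mult_left_mono) auto

text \<open>With common index sets and weights \<open>pmf p \<psi>\<close>, each side merges into
  one double sum, and nonnegative weights reduce the claim to the indicators.\<close>

lemma f_plt_loss_supermodular:
  "f_plt_loss G r p \<phi> U X + f_plt_loss G r p \<phi> U Y
    \<le> f_plt_loss G r p \<phi> U (X \<union> Y) + f_plt_loss G r p \<phi> U (X \<inter> Y)"
  unfolding f_plt_loss_def sum.distrib[symmetric] distrib_left[symmetric]
  by (intro sum_mono mult_left_mono of_bool_Ball_supermodular pmf_nonneg)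

theorem theorem2:
  fixes G :: "('a, 'b) pre_digraph" and r :: 'a
    and p :: "('a \<rightharpoonup> bool) pmf" and \<phi> :: "'a \<rightharpoonup> bool" and U :: "'a set"
  assumes "pseudo_graph G"
    and "r \<in> verts G"
    and "set_pmf p \<subseteq> full_realizations G r"
    and "dom \<phi> \<subseteq> verts G"
    and "\<phi> r = Some True"
    and "extension_mass G r p \<phi> > 0"
    and "U \<subseteq> dom \<phi>"
    and "r \<in> U"
  defines "R \<equiv> root_component G r p \<phi> U"
  shows "(\<forall>X\<subseteq>R. f_plt G r p \<phi> U X \<ge> 0) \<and>
         (\<forall>X Y. X \<subseteq> Y \<longrightarrow> Y \<subseteq> R \<longrightarrow> f_plt G r p \<phi> U X \<le> f_plt G r p \<phi> U Y) \<and>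
         submodular_on R (f_plt G r p \<phi> U)"
proof -
  interpret pseudo_graph G by fact
  \<comment> \<open>Subtracting the loss from a constant reverses each inequality: antitone becomes
    monotone, supermodular becomes submodular.\<close>
  note eq = f_plt_eq_card_minus_loss[OF finite_verts, of r p \<phi> U]
  have "f_plt G r p \<phi> U X \<ge> 0" for X
    using f_plt_loss_le_card[of G r p \<phi> U X] by (simp add: eq)
  moreover have "f_plt G r p \<phi> U X \<le> f_plt G r p \<phi> U Y" if "X \<subseteq> Y" for X Y
    using f_plt_loss_antimono[OF that, of G r p \<phi> U] by (simp add: eq)
  moreover have "f_plt G r p \<phi> U (X \<union> Y) + f_plt G r p \<phi> U (X \<inter> Y)
      \<le> f_plt G r p \<phi> U X + f_plt G r p \<phi> U Y" for X Y
    using f_plt_loss_supermodular[of G r p \<phi> U X Y] by (simp add: eq)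
  ultimately show ?thesis
    by (simp add: submodular_on_def)
qed

end
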